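(* Let $A$ be a finite set with at least three elements and let $\eta=\{(a,b)\in A^2\mid a\neq b\}$. Then $\mathrm{PPol}(\eta)=\mathrm{Deg}(A)$.
   Context: $B_n(A)=\mathrm{Sym}(A^n)$, $B(A)=\bigcup_n B_n(A)$. For a relation $R\subseteq A^k$, $\mathrm{PPol}(R)$ is the set of $f\in B_n(A)$ ($n\in\mathbb{N}$) such that for every $k\times n$ array with all columns in $R$, applying $f$ to each row yields an array with all columns in $R$. For $\alpha\in S_n$, $\pi_\alpha(x_1,\dots,x_n)=(x_{\alpha^{-1}(1)},\dots,x_{\alpha^{-1}(n)})$. $\mathrm{Deg}(A)=\{\pi_\alpha\bullet(\beta_1\oplus\dots\oplus\beta_n)\mid n\in\mathbb{N},\alpha\in S_n,\beta_i\in\mathrm{Sym}(A)\}$, where $\beta_1\oplus\dots\oplus\beta_n$ acts coordinatewise by $\beta_i$ on the $i$-th coordinate and $\bullet$ is composition; i.e. $\mathrm{Deg}(A)=\bigcup_n \mathrm{Sym}(A)\,\mathrm{wr}\,S_n$ (the degenerate, or essentially unary, permutations). *)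

theory Defs
  imports
    "HOL-Algebra.Bij"
    "HOL-Library.NList"
    "HOL-Combinatorics.Permutations"
begin

text \<open>
  Elements of \<open>A\<^sup>n\<close> are lists in \<^term>\<open>nlists n A\<close>, with coordinates numbered from \<open>0\<close>.
  Permutations are extensional, i.e. \<^const>\<open>undefined\<close> outside their domain, rather than the
  identity there; otherwise the identities of all the \<open>A\<^sup>n\<close> would be one and the same function.
  For \<open>card A \<ge> 2\<close> a function thus lies in \<open>B\<^sub>n(A)\<close> for at most one \<open>n\<close>
  (see \<open>B_arity_unique\<close>).
\<close>

definition B :: "nat \<Rightarrow> 'a set \<Rightarrow> ('a list \<Rightarrow> 'a list) set" where
  "B n A = Bij (nlists n A)"

text \<open>An array is the list of its rows.\<close>

definition column :: "'a list list \<Rightarrow> nat \<Rightarrow> 'a list" where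
  "column M j = map (\<lambda>r. r ! j) M"

definition preserves :: "nat \<Rightarrow> 'a set \<Rightarrow> nat \<Rightarrow> 'a list set \<Rightarrow> ('a list \<Rightarrow> 'a list) \<Rightarrow> bool" where
  "preserves n A k R f \<longleftrightarrow>
    (\<forall>M \<in> nlists k (nlists n A).
       (\<forall>j<n. column M j \<in> R) \<longrightarrow> (\<forall>j<n. column (map f M) j \<in> R))"

definition PPol :: "'a set \<Rightarrow> nat \<Rightarrow> 'a list set \<Rightarrow> ('a list \<Rightarrow> 'a list) set" where
  "PPol A k R = (\<Union>n. {f \<in> B n A. preserves n A k R f})"

definition wire_perm :: "nat \<Rightarrow> 'a set \<Rightarrow> (nat \<Rightarrow> nat) \<Rightarrow> 'a list \<Rightarrow> 'a list" where
  "wire_perm n A \<alpha> = (\<lambda>x\<in>nlists n A. map (\<lambda>i. x ! (Hilbert_Choice.inv \<alpha> i)) [0..<n])"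

definition coordwise :: "nat \<Rightarrow> 'a set \<Rightarrow> (nat \<Rightarrow> 'a \<Rightarrow> 'a) \<Rightarrow> 'a list \<Rightarrow> 'a list" where
  "coordwise n A \<beta> = (\<lambda>x\<in>nlists n A. map (\<lambda>i. \<beta> i (x ! i)) [0..<n])"

definition Deg :: "'a set \<Rightarrow> ('a list \<Rightarrow> 'a list) set" where
  "Deg A = {compose (nlists n A) (wire_perm n A \<alpha>) (coordwise n A \<beta>) | n \<alpha> \<beta>.
              \<alpha> permutes {..<n} \<and> (\<forall>i<n. \<beta> i \<in> Bij A)}"

definition neq_rel :: "'a set \<Rightarrow> 'a list set" where
  "neq_rel A = {[a, b] | a b. a \<in> A \<and> b \<in> A \<and> a \<noteq> b}"

lemma B_arity_unique:
  assumes "card A \<ge> 2" and "f \<in> B m A" and "f \<in> B n A"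
  shows "m = n"
proof -
  have *: False if f: "f \<in> B m A" "f \<in> B n A" and ne: "m \<noteq> n" and m: "m > 0" for m n
  proof -
    obtain T where "T \<subseteq> A" "card T = 2"
      using assms(1) by (rule obtain_subset_with_card_n)
    moreover from this(2) obtain a b where "T = {a, b}" "a \<noteq> b"
      unfolding card_2_iff by blast
    ultimately have ab: "a \<in> A" "b \<in> A" "a \<noteq> b"
      by simp_all
    let ?x = "replicate m a" and ?y = "replicate m b"
    have in_m: "?x \<in> nlists m A" "?y \<in> nlists m A"
      using ab by (auto intro!: nlistsI)
    have "?x \<notin> nlists n A" "?y \<notin> nlists n A"
      using ne by (auto dest: nlistsE_length)
    then have "f ?x = f ?y"
      using f(2) by (simp add: B_def Bij_def extensional_def)
    moreover have "inj_on f (nlists m A)"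
      using f(1) by (simp add: B_def Bij_def bij_betw_def)
    ultimately have "?x = ?y"
      using in_m by (simp only: inj_on_eq_iff)
    then show False
      using m ab(3) by simp
  qed
  show ?thesis
  proof (rule ccontr)
    assume "m \<noteq> n"
    then show False
      using *[OF assms(2,3)] *[OF assms(3,2)] by (cases "m > 0") simp_all
  qed
qed

end

theory Submission
  imports Defs
begin

text \<open>
  Points \<open>x\<close>, \<open>y\<close> of \<open>A\<^sup>n\<close> at Hamming distance \<open>h\<close> have \<open>(q - 1)\<^bsup>n - h\<^esup> (q - 2)\<^bsup>h\<^esup>\<close> common
  everywhere-different points, where \<open>q = card A\<close>. For \<open>q \<ge> 3\<close> this is strictly decreasing in
  \<open>h\<close>, so a permutation preserving \<open>\<noteq>\<close> cannot increase the Hamming distance. As it also preserves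
  distance \<open>n\<close>, it maps consecutive steps in disjoint sets of coordinates to steps in disjoint
  sets of coordinates. Hence a coordinate of the image cannot react to changes in two different
  coordinates of the argument.
\<close>

declare nlistsE_length [simp del] nlistsE_set [simp del]

section \<open>Differing coordinates of two points, and inequality of columns in terms of
  them\<close>

text \<open>For points of \<open>nlists n A\<close> its cardinality is their Hamming distance. The
  set itself is kept because disjointness of successive changes matters later, not only their
  number.\<close>

definition diff_set :: "nat \<Rightarrow> 'a list \<Rightarrow> 'a list \<Rightarrow> nat set" where
  "diff_set n x y = {i. i < n \<and> x ! i \<noteq> y ! i}"

lemma diff_set_iff [simp]: "i \<in> diff_set n x y \<longleftrightarrow> i < n \<and> x ! i \<noteq> y ! i"
  by (simp add: diff_set_def)

lemma diff_set_subset: "diff_set n x y \<subseteq> {..<n}"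
  by auto

lemma finite_diff_set [simp]: "finite (diff_set n x y)"
  using finite_subset[OF diff_set_subset] by blast

lemma diff_set_eq_full_iff: "diff_set n x y = {..<n} \<longleftrightarrow> (\<forall>i<n. x ! i \<noteq> y ! i)"
  by (auto simp: diff_set_def)

lemma diff_set_eq_singleton_iff:
  "diff_set n x y = {j} \<longleftrightarrow> j < n \<and> x ! j \<noteq> y ! j \<and> (\<forall>i<n. i \<noteq> j \<longrightarrow> x ! i = y ! i)"
  by (auto simp: diff_set_def)

lemma diff_set_commute: "diff_set n x y = diff_set n y x"
  by auto

lemma diff_set_triangle: "diff_set n x z \<subseteq> diff_set n x y \<union> diff_set n y z"
  by auto

lemma nlists_nth_eqI:
  assumes "x \<in> nlists n A" "y \<in> nlists n A" "\<And>i. i < n \<Longrightarrow> x ! i = y ! i"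
  shows "x = y"
  using assms by (intro nth_equalityI) (auto dest: nlistsE_length)

lemma map_upt_in_nlists:
  assumes "\<And>i. i < n \<Longrightarrow> g i \<in> A"
  shows "map g [0..<n] \<in> nlists n A"
  using assms by (auto intro!: nlistsI)

lemma nth_list_update_nlists:
  assumes "x \<in> nlists n A" "i < n"
  shows "x[i := a] ! j = (if j = i then a else x ! j)"
  using assms by (auto simp: nlists_def)

lemma finite_nlists:
  assumes "finite A"
  shows "finite (nlists n A)"
  using finite_lists_length_eq[OF assms, of n] unfolding nlists_def by (simp add: conj_commute)

lemma Bij_nlistsI:
  assumes "finite A" "f \<in> extensional (nlists n A)" "inj_on f (nlists n A)"
    and "\<And>x. x \<in> nlists n A \<Longrightarrow> f x \<in> nlists n A"
  shows "f \<in> Bij (nlists n A)"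
  using assms endo_inj_surj[OF finite_nlists[OF assms(1)], of f n]
  by (auto simp: Bij_def bij_betw_def)

text \<open>An array with two rows has all its columns in \<open>neq_rel A\<close> exactly when the
  rows differ everywhere. Closure under \<open>f\<close> is assumed because columns of the image
  must again have entries in \<open>A\<close>.\<close>

lemma preserves_neq_rel_iff:
  assumes "\<And>x. x \<in> nlists n A \<Longrightarrow> f x \<in> nlists n A"
  shows "preserves n A 2 (neq_rel A) f \<longleftrightarrow>
    (\<forall>x \<in> nlists n A. \<forall>y \<in> nlists n A.
       diff_set n x y = {..<n} \<longrightarrow> diff_set n (f x) (f y) = {..<n})"
proof -
  have two: "(\<forall>M \<in> nlists 2 S. P M) \<longleftrightarrow> (\<forall>x \<in> S. \<forall>y \<in> S. P [x, y])"
    for S :: "'b set" and P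
    by (auto simp: numeral_2_eq_2 in_nlists_Suc_iff)
  have col: "(\<forall>j<n. column [x, y] j \<in> neq_rel A) \<longleftrightarrow> diff_set n x y = {..<n}"
    if "x \<in> nlists n A" "y \<in> nlists n A" for x y
    using that by (auto simp: column_def neq_rel_def nlists_def set_eq_iff)
  show ?thesis
    unfolding preserves_def two by (simp add: col assms)
qed

section \<open>Counting common everywhere-different points\<close>

lemma card_nlists_coordinates_in:
  "card {z \<in> nlists n A. \<forall>i<n. z ! i \<in> S i} = (\<Prod>i<n. card (A \<inter> S i))"
proof -
  let ?Z = "{z \<in> nlists n A. \<forall>i<n. z ! i \<in> S i}"
  let ?P = "PiE {..<n} (\<lambda>i. A \<inter> S i)"
  have "bij_betw (\<lambda>g. map g [0..<n]) ?P ?Z"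
  proof (rule bij_betw_byWitness[where f' = "\<lambda>z. \<lambda>i\<in>{..<n}. z ! i"])
    show "\<forall>g\<in>?P. (\<lambda>i\<in>{..<n}. map g [0..<n] ! i) = g"
      by (auto simp: PiE_def extensional_def fun_eq_iff)
    show "\<forall>z\<in>?Z. map (\<lambda>i\<in>{..<n}. z ! i) [0..<n] = z"
      by (auto simp: nlists_def intro!: nth_equalityI)
    show "(\<lambda>g. map g [0..<n]) ` ?P \<subseteq> ?Z"
      by (auto simp: nlists_def PiE_def Pi_def)
    show "(\<lambda>z. \<lambda>i\<in>{..<n}. z ! i) ` ?Z \<subseteq> ?P"
      by (auto simp: nlistsE_nth_in split: if_splits)
  qed
  then have "card ?Z = card ?P"
    by (simp add: bij_betw_same_card)
  then show ?thesis
    by (simp add: card_PiE)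
qed

text \<open>The coordinates of \<open>z\<close> can be chosen independently: one value is forbidden
  where \<open>x\<close> and \<open>y\<close> agree, two where they differ.\<close>

lemma card_common_everywhere_different:
  assumes "finite A" "x \<in> nlists n A" "y \<in> nlists n A"
  shows "card {z \<in> nlists n A. diff_set n x z = {..<n} \<and> diff_set n y z = {..<n}} =
    (card A - 1) ^ (n - card (diff_set n x y)) * (card A - 2) ^ card (diff_set n x y)"
proof -
  let ?D = "diff_set n x y"
  have in_A: "x ! i \<in> A" "y ! i \<in> A" if "i < n" for i
    using assms(2,3) that by (auto simp: nlists_def)
  have "{z \<in> nlists n A. diff_set n x z = {..<n} \<and> diff_set n y z = {..<n}} =
      {z \<in> nlists n A. \<forall>i<n. z ! i \<in> - {x ! i, y ! i}}"
    by (auto simp: diff_set_eq_full_iff)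
  then have "card {z \<in> nlists n A. diff_set n x z = {..<n} \<and> diff_set n y z = {..<n}} =
      (\<Prod>i<n. card (A - {x ! i, y ! i}))"
    using card_nlists_coordinates_in[of n A "\<lambda>i. - {x ! i, y ! i}"] by (simp only: Diff_eq)
  also have "\<dots> = (\<Prod>i<n. if i \<in> ?D then card A - 2 else card A - 1)"
    using in_A assms(1) by (intro prod.cong) (auto simp: card_Diff_subset)
  also have "\<dots> = (card A - 2) ^ card ({..<n} \<inter> ?D) * (card A - 1) ^ card ({..<n} \<inter> - ?D)"
    by (simp only: prod.If_cases finite_lessThan prod_constant Collect_mem_eq)
  also have "{..<n} \<inter> ?D = ?D"
    using diff_set_subset by (rule Int_absorb1)
  also have "{..<n} \<inter> - ?D = {..<n} - ?D"
    by (rule Diff_eq[symmetric])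
  also have "card ({..<n} - ?D) = n - card ?D"
    by (simp add: card_Diff_subset diff_set_subset)
  finally show ?thesis
    by (simp add: mult.commute)
qed

text \<open>Raising the exponent \<open>h\<close> by \<open>d\<close> trades \<open>d\<close>
  factors \<open>a + 1\<close> for factors \<open>a\<close>. After cancelling the common factors,
  which are positive as \<open>a \<ge> 1\<close>, the inequality would read
  \<open>(a + 1) ^ d \<le> a ^ d\<close>.\<close>

lemma mixed_power_le_imp_exponent_ge:
  fixes a :: nat
  assumes "a \<ge> 1" "h \<le> n" "h' \<le> n"
    and le: "(a + 1) ^ (n - h) * a ^ h \<le> (a + 1) ^ (n - h') * a ^ h'"
  shows "h' \<le> h"
proof (rule ccontr)
  assume "\<not> h' \<le> h"
  then obtain d where d: "h' = h + d" "d > 0"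
    by (metis less_imp_add_positive not_le)
  then have "n - h = (n - h') + d"
    using assms(3) by simp
  then have "(a + 1) ^ (n - h') * a ^ h * (a + 1) ^ d \<le> (a + 1) ^ (n - h') * a ^ h * a ^ d"
    using le d(1) by (simp add: power_add mult_ac)
  then have "(a + 1) ^ d \<le> a ^ d"
    using assms(1) by simp
  moreover have "a ^ d < (a + 1) ^ d"
    using d(2) by (intro power_strict_mono) auto
  ultimately show False
    by simp
qed

section \<open>Hamming distances under a permutation preserving inequality\<close>

locale neq_preserving_permutation =
  fixes A :: "'a set" and n :: nat and f :: "'a list \<Rightarrow> 'a list"
  assumes finite_A: "finite A"
    and card_A: "card A \<ge> 3"
    and bij: "f \<in> Bij (nlists n A)"
    and full: "\<And>x y. x \<in> nlists n A \<Longrightarrow> y \<in> nlists n A \<Longrightarrow>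
      diff_set n x y = {..<n} \<Longrightarrow> diff_set n (f x) (f y) = {..<n}"
begin

abbreviation "N \<equiv> nlists n A"
abbreviation "D \<equiv> diff_set n"

lemma inj: "inj_on f N"
  using bij by (simp add: Bij_def bij_betw_def)

lemma closed: "x \<in> N \<Longrightarrow> f x \<in> N"
  using bij by (auto simp: Bij_def bij_betw_def)

lemma obtain_other:
  obtains b where "b \<in> A" "b \<noteq> a"
proof -
  have "\<not> A \<subseteq> {a}"
    using card_A card_mono[of "{a}" A] by auto
  then show ?thesis
    using that by auto
qed

text \<open>\<open>f\<close> injects the common everywhere-different points of \<open>x\<close> and
  \<open>y\<close> into those of \<open>f x\<close> and \<open>f y\<close>, and fewer such points
  mean a larger distance.\<close>

lemma card_diff_set_image_le:
  assumes "x \<in> N" "y \<in> N"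
  shows "card (D (f x) (f y)) \<le> card (D x y)"
proof -
  let ?C = "\<lambda>x y. {z \<in> N. D x z = {..<n} \<and> D y z = {..<n}}"
  have "f ` ?C x y \<subseteq> ?C (f x) (f y)"
    using assms closed full by auto
  moreover have "finite (?C (f x) (f y))"
    using finite_nlists[OF finite_A] by simp
  moreover have "inj_on f (?C x y)"
    using inj by (rule inj_on_subset) auto
  ultimately have "card (?C x y) \<le> card (?C (f x) (f y))"
    by (intro card_inj_on_le[of f])
  then have le: "(card A - 1) ^ (n - card (D x y)) * (card A - 2) ^ card (D x y) \<le>
      (card A - 1) ^ (n - card (D (f x) (f y))) * (card A - 2) ^ card (D (f x) (f y))"
    using assms closed finite_A by (simp only: card_common_everywhere_different)
  have le_n: "card (D u v) \<le> n" for u v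
    using card_mono[OF _ diff_set_subset, of n u v] by simp
  \<comment> \<open>The bound on \<open>card A\<close> enters here: \<open>a \<ge> 1\<close> makes
    the count strictly decreasing in the distance.\<close>
  obtain a where "card A = a + 2" "a \<ge> 1"
    using card_A that[of "card A - 2"] by simp
  then show ?thesis
    using le by (intro mixed_power_le_imp_exponent_ge[OF _ le_n le_n, of a]) simp_all
qed

text \<open>
  Continue the two steps to a point \<open>w\<close> that differs everywhere from \<open>x\<close>: the images of the three
  steps must together change all \<open>n\<close> coordinates, so none can be changed twice.
\<close>

lemma disjoint_steps:
  assumes N: "x \<in> N" "y \<in> N" "z \<in> N" and disj: "D x y \<inter> D y z = {}"
  shows "D (f x) (f y) \<inter> D (f y) (f z) = {}"
proof -
  have "\<exists>b. b \<in> A \<and> b \<noteq> a" for a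
    by (metis obtain_other)
  then obtain other where other: "other a \<in> A" "other a \<noteq> a" for a
    by metis
  \<comment> \<open>\<open>w\<close> keeps the entries of \<open>z\<close> that already differ from
    \<open>x\<close> and changes all others, so it differs from \<open>x\<close> everywhere and from
    \<open>z\<close> exactly where \<open>z\<close> agrees with \<open>x\<close>.\<close>
  define w where "w = map (\<lambda>i. if x ! i \<noteq> z ! i then z ! i else other (x ! i)) [0..<n]"
  have w: "w \<in> N"
    unfolding w_def using N other by (intro map_upt_in_nlists) (auto simp: nlistsE_nth_in)
  have "D x w = {..<n}"
    using other[of "x ! _"] by (auto simp: w_def diff_set_eq_full_iff eq_commute[of "x ! _"])
  then have full_image: "D (f x) (f w) = {..<n}"
    using N w full by blast
  \<comment> \<open>No coordinate is changed twice, so no change from \<open>x\<close> to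
    \<open>y\<close> is undone on the way to \<open>z\<close>.\<close>
  have "D x y \<union> D y z = D x z"
    using disj by (fastforce simp: diff_set_def)
  moreover have "D z w = {..<n} - D x z"
    using other(2) by (auto simp: w_def eq_commute[of "x ! _"])
  ultimately have "D z w = {..<n} - (D x y \<union> D y z)"
    by simp
  then have "card (D z w) = n - card (D x y \<union> D y z)"
    by (simp add: card_Diff_subset diff_set_subset)
  then have "card (D z w) = n - (card (D x y) + card (D y z))"
    using disj by (simp add: card_Un_disjoint)
  moreover have "card (D x y) + card (D y z) \<le> n"
    using disj card_mono[of "{..<n}" "D x y \<union> D y z"]
    by (simp add: card_Un_disjoint diff_set_subset)
  ultimately have total: "card (D x y) + card (D y z) + card (D z w) = n"
    by simp
  have "{..<n} \<subseteq> (D (f x) (f y) \<union> D (f y) (f z)) \<union> D (f z) (f w)"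
    using full_image diff_set_triangle by blast
  then have "n \<le> card ((D (f x) (f y) \<union> D (f y) (f z)) \<union> D (f z) (f w))"
    using card_mono[of _ "{..<n}"] by (metis card_lessThan finite_Un finite_diff_set)
  also have "\<dots> \<le> card (D (f x) (f y) \<union> D (f y) (f z)) + card (D (f z) (f w))"
    by (rule card_Un_le)
  \<comment> \<open>The third image step accounts for at most \<open>card (D z w)\<close>
    coordinates. The first two must cover the rest, which is as many as their sizes allow even
    without overlap.\<close>
  finally have "card (D x y) + card (D y z) \<le> card (D (f x) (f y) \<union> D (f y) (f z))"
    using total card_diff_set_image_le[OF N(3) w] by linarith
  moreover have "card (D (f x) (f y) \<union> D (f y) (f z)) + card (D (f x) (f y) \<inter> D (f y) (f z)) =
      card (D (f x) (f y)) + card (D (f y) (f z))"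
    by (rule card_Un_Int[symmetric]) simp_all
  ultimately have "card (D (f x) (f y) \<inter> D (f y) (f z)) = 0"
    using card_diff_set_image_le[OF N(1,2)] card_diff_set_image_le[OF N(2,3)] by linarith
  then show ?thesis
    by simp
qed

text \<open>Injectivity forces at least one change, and the distance bound permits at most
  one.\<close>

lemma single_step_image:
  assumes "x \<in> N" "y \<in> N" "D x y = {j}"
  obtains p where "D (f x) (f y) = {p}"
proof -
  have "f x \<noteq> f y"
    using assms inj by (auto simp: inj_on_eq_iff)
  then have "D (f x) (f y) \<noteq> {}"
    using nlists_nth_eqI[OF closed closed, OF assms(1,2)] by (auto simp: set_eq_iff)
  moreover have "card (D (f x) (f y)) \<le> 1"
    using card_diff_set_image_le[OF assms(1,2)] assms(3) by simp
  ultimately have "card (D (f x) (f y)) = 1"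
    by (metis card_0_eq finite_diff_set le_antisym less_one not_le)
  then show ?thesis
    using that by (auto simp: card_1_singleton_iff)
qed

section \<open>Each image coordinate reacts to a single argument coordinate\<close>

text \<open>One base point suffices: a priori, the image coordinate moved by a step in coordinate
  \<open>j\<close> may depend on where the step starts.\<close>

definition reacts :: "nat \<Rightarrow> nat \<Rightarrow> bool" where
  "reacts p j \<longleftrightarrow> (\<exists>x \<in> N. \<exists>y \<in> N. D x y = {j} \<and> p \<in> D (f x) (f y))"

text \<open>The points obtained from \<open>x\<close> by varying coordinate \<open>j\<close> have
  images pairwise at distance one, and these all differ in the same coordinate \<open>p\<close>.
  Thus a step witnessing a reaction can be made to end at any prescribed value in coordinate
  \<open>j\<close>.\<close>

lemma step_on_line:
  assumes N: "x \<in> N" "y \<in> N" and step: "D x y = {j}" "p \<in> D (f x) (f y)" and c: "c \<in> A"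
  obtains u where "u \<in> N" "D u (x[j := c]) = {j}" "p \<in> D (f u) (f (x[j := c]))"
proof -
  have j: "j < n" "x ! j \<noteq> y ! j" and agree: "\<And>i. i < n \<Longrightarrow> i \<noteq> j \<Longrightarrow> x ! i = y ! i"
    using step(1) by (auto simp: diff_set_eq_singleton_iff)
  let ?z = "x[j := c]"
  have z: "?z \<in> N"
    using N(1) c by (rule nlists_update_in_list)
  have nth_z: "?z ! i = (if i = j then c else x ! i)" for i
    using nth_list_update_nlists[OF N(1) j(1)] .
  consider "c = x ! j" | "c = y ! j" | "c \<noteq> x ! j" "c \<noteq> y ! j"
    by blast
  then show ?thesis
  proof cases
    case 1
    then have "?z = x"
      by simp
    then show ?thesis
      using that[of y] N step diff_set_commute[of n x y] diff_set_commute[of n "f x" "f y"] by simp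
  next
    case 2
    then have "?z = y"
      using z N(2) agree nth_z by (intro nlists_nth_eqI[of _ n A]) auto
    then show ?thesis
      using that[of x] N step by simp
  next
    case 3
    have Dxz: "D x ?z = {j}" and Dyz: "D y ?z = {j}"
      using 3 j agree by (auto simp: nth_z diff_set_eq_singleton_iff)
    obtain p' where p': "D (f x) (f ?z) = {p'}"
      using single_step_image[OF N(1) z Dxz] .
    obtain r where r: "D (f y) (f ?z) = {r}"
      using single_step_image[OF N(2) z Dyz] .
    obtain s where s: "D (f x) (f y) = {s}"
      using single_step_image[OF N step(1)] .
    \<comment> \<open>Otherwise \<open>f y\<close> and \<open>f ?z\<close> would differ in both
      \<open>p\<close> and \<open>p'\<close>, although they differ only in \<open>r\<close>.\<close>
    have "p' = p"
    proof (rule ccontr)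
      assume "p' \<noteq> p"
      then have "p \<notin> D (f x) (f ?z)" "p' \<notin> D (f x) (f y)"
        using p' s step(2) by auto
      moreover have "p \<in> D (f x) (f y)" "p' \<in> D (f x) (f ?z)"
        using p' step(2) by auto
      ultimately have "p \<in> D (f y) (f ?z)" "p' \<in> D (f y) (f ?z)"
        by auto
      then show False
        using r \<open>p' \<noteq> p\<close> by auto
    qed
    then show ?thesis
      using that[of x] N Dxz p' by simp
  qed
qed

text \<open>
  Moving the two steps along their lines, we may assume that their base points agree in the
  coordinates \<open>j\<close> and \<open>k\<close>; then they are part of one path whose steps are disjoint.
\<close>

lemma reacts_unique:
  assumes "reacts p j" "reacts p k"
  shows "j = k"
proof (rule ccontr)
  assume "j \<noteq> k"
  obtain x x' where x: "x \<in> N" "x' \<in> N" "D x x' = {j}" "p \<in> D (f x) (f x')"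
    using assms(1) unfolding reacts_def by blast
  obtain y y' where y: "y \<in> N" "y' \<in> N" "D y y' = {k}" "p \<in> D (f y) (f y')"
    using assms(2) unfolding reacts_def by blast
  have jk: "j < n" "k < n"
    using x(3) y(3) by (simp_all add: diff_set_eq_singleton_iff)
  define s where "s = x[j := y ! j]"
  define r where "r = y[k := x ! k]"
  obtain t where t: "t \<in> N" "D t s = {j}" "p \<in> D (f t) (f s)"
    using step_on_line[OF x nlistsE_nth_in[OF y(1) jk(1)]] unfolding s_def .
  obtain w where w: "w \<in> N" "D w r = {k}" "p \<in> D (f w) (f r)"
    using step_on_line[OF y nlistsE_nth_in[OF x(1) jk(2)]] unfolding r_def .
  have sr: "s \<in> N" "r \<in> N"
    unfolding s_def r_def using x y jk by (auto intro!: nlists_update_in_list nlistsE_nth_in)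
  have "s ! j = r ! j" "s ! k = r ! k"
    using \<open>j \<noteq> k\<close> jk x(1) y(1) by (auto simp: s_def r_def nth_list_update_nlists)
  then have notin: "j \<notin> D s r" "k \<notin> D s r"
    by auto
  \<comment> \<open>The path is \<open>t\<close>, \<open>s\<close>, \<open>r\<close>,
    \<open>w\<close>. Comparing its first step with the whole remainder shows that coordinate
    \<open>p\<close> of the image is unchanged from \<open>s\<close> to \<open>w\<close>. Comparing
    its last two steps shows that it is unchanged from \<open>s\<close> to \<open>r\<close>, so it
    cannot change from \<open>r\<close> to \<open>w\<close>.\<close>
  have "D s w \<subseteq> D s r \<union> {k}"
    using diff_set_triangle[of n s w r] w(2) by (simp add: diff_set_commute)
  then have "D t s \<inter> D s w = {}"
    unfolding t(2) using notin(1) \<open>j \<noteq> k\<close> by blast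
  then have "p \<notin> D (f s) (f w)"
    using disjoint_steps[OF t(1) sr(1) w(1)] t(3) by blast
  moreover have "p \<notin> D (f s) (f r)"
  proof -
    have "D r w = {k}" "p \<in> D (f r) (f w)"
      using w(2,3) by (simp_all only: diff_set_commute[of n w] diff_set_commute[of n "f w"])
    then show ?thesis
      using disjoint_steps[OF sr w(1)] notin(2)
      by (metis Int_empty_right Int_insert_right_if0 disjoint_iff)
  qed
  ultimately show False
    using w(3) by auto
qed

text \<open>Turn \<open>x\<close> into \<open>y\<close> by correcting one coordinate at a time; some
  step must change coordinate \<open>p\<close> of the image.\<close>

lemma reacts_on_path:
  assumes "x \<in> N" "y \<in> N" "p \<in> D (f x) (f y)"
  shows "\<exists>j \<in> D x y. reacts p j"
  using assms
proof (induction "card (D x y)" arbitrary: x rule: less_induct)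
  case less
  have "x \<noteq> y"
    using less.prems(3) by auto
  then have "D x y \<noteq> {}"
    using nlists_nth_eqI[OF less.prems(1,2)] by (auto simp: set_eq_iff)
  then obtain i where i: "i \<in> D x y"
    by blast
  let ?x = "x[i := y ! i]"
  have x': "?x \<in> N"
    using less.prems i by (intro nlists_update_in_list nlistsE_nth_in) auto
  have nth_x': "?x ! k = (if k = i then y ! i else x ! k)" for k
    using i nth_list_update_nlists[OF less.prems(1)] by auto
  have Dxx': "D x ?x = {i}"
    using i by (simp add: nth_x' diff_set_eq_singleton_iff)
  have Dx'y: "D ?x y = D x y - {i}"
    by (rule Set.set_eqI) (simp add: nth_x')
  show ?case
  proof (cases "p \<in> D (f x) (f ?x)")
    case True
    then have "reacts p i"
      using less.prems x' Dxx' unfolding reacts_def by blast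
    then show ?thesis
      using i by blast
  next
    case False
    then have "p \<in> D (f ?x) (f y)"
      using less.prems(3) by auto
    moreover have "card (D ?x y) < card (D x y)"
      unfolding Dx'y using i by (intro card_Diff1_less) auto
    ultimately show ?thesis
      using less.hyps x' less.prems(2) Dx'y by blast
  qed
qed

text \<open>Two different constant lists have everywhere-different images, so \<open>p\<close>
  reacts to some \<open>j\<close>. By uniqueness no path that leaves coordinate \<open>j\<close>
  alone can affect \<open>p\<close>.\<close>

lemma depends_on_one_coordinate:
  assumes "p < n"
  shows "\<exists>j<n. \<forall>x \<in> N. \<forall>y \<in> N. x ! j = y ! j \<longrightarrow> f x ! p = f y ! p"
proof -
  obtain a b where ab: "a \<in> A" "b \<in> A" "a \<noteq> b"
    using obtain_other by metis
  then have const: "replicate n a \<in> N" "replicate n b \<in> N"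
    by (auto simp: nlists_def)
  have "D (replicate n a) (replicate n b) = {..<n}"
    using ab by auto
  then have "p \<in> D (f (replicate n a)) (f (replicate n b))"
    using full const assms by blast
  then have "\<exists>j \<in> D (replicate n a) (replicate n b). reacts p j"
    by (rule reacts_on_path[OF const])
  then obtain j where j: "j < n" "reacts p j"
    by auto
  have "f x ! p = f y ! p" if "x \<in> N" "y \<in> N" "x ! j = y ! j" for x y
    using reacts_on_path[OF that(1,2), of p] reacts_unique j(2) assms that(3) by fastforce
  then show ?thesis
    using j(1) by blast
qed

section \<open>Reading off the wire permutation and the coordinate permutations\<close>

lemma in_Deg: "f \<in> Deg A"
proof -
  obtain \<tau> where \<tau>: "\<And>p. p < n \<Longrightarrow> \<tau> p < n"
    and dep: "\<And>p x y. \<lbrakk>p < n; x \<in> N; y \<in> N; x ! \<tau> p = y ! \<tau> p\<rbrakk> \<Longrightarrow> f x ! p = f y ! p"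
    using depends_on_one_coordinate by metis
  have const: "replicate n a \<in> N" if "a \<in> A" for a
    using that by (auto simp: nlists_def)
  \<comment> \<open>The constant list with entry \<open>x ! \<tau> p\<close> agrees with
    \<open>x\<close> at the only coordinate that \<open>p\<close> reads, so constant lists determine
    \<open>f\<close>.\<close>
  have f_nth: "f x ! p = f (replicate n (x ! \<tau> p)) ! p" if "x \<in> N" "p < n" for x p
    using that \<tau> by (intro dep const nlistsE_nth_in) auto
  have "{..<n} \<subseteq> \<tau> ` {..<n}"
  proof
    fix j assume "j \<in> {..<n}"
    then have j: "j < n"
      by simp
    show "j \<in> \<tau> ` {..<n}"
    proof (rule ccontr)
      \<comment> \<open>If no image coordinate read \<open>j\<close>, changing entry
        \<open>j\<close> would not change the image, against injectivity.\<close>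
      assume missing: "j \<notin> \<tau> ` {..<n}"
      obtain a b where ab: "a \<in> A" "b \<in> A" "a \<noteq> b"
        using obtain_other by metis
      let ?x = "replicate n a" and ?y = "(replicate n a)[j := b]"
      have N: "?x \<in> N" "?y \<in> N"
        using ab const by (simp_all add: nlists_update_in_list)
      have "f ?x ! p = f ?y ! p" if "p < n" for p
      proof -
        have "\<tau> p \<noteq> j"
          using missing that by auto
        then show ?thesis
          using that N by (intro dep) auto
      qed
      then have "f ?x = f ?y"
        using N closed by (intro nlists_nth_eqI[of _ n A]) auto
      then have "?x = ?y"
        using inj N by (simp add: inj_on_eq_iff)
      then have "?x ! j = ?y ! j"
        by simp
      then show False
        using j ab(3) by simp
    qed
  qed
  moreover have "\<tau> ` {..<n} \<subseteq> {..<n}"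
    using \<tau> by auto
  ultimately have image: "\<tau> ` {..<n} = {..<n}"
    by auto
  then have inj_\<tau>: "inj_on \<tau> {..<n}"
    by (intro eq_card_imp_inj_on) auto
  \<comment> \<open>\<open>permutes\<close> requires the identity outside \<open>{..<n}\<close>,
    where nothing is known about \<open>\<tau>\<close>.\<close>
  define \<sigma> where "\<sigma> i = (if i < n then \<tau> i else i)" for i
  have \<sigma>: "\<sigma> permutes {..<n}"
  proof (rule bij_imp_permutes)
    show "bij_betw \<sigma> {..<n} {..<n}"
      using image inj_\<tau> by (simp add: bij_betw_def \<sigma>_def inj_on_def)
  qed (simp add: \<sigma>_def)
  \<comment> \<open>The index is an argument coordinate, since \<open>coordwise\<close> acts before
    the wires are permuted; \<open>Hilbert_Choice.inv \<sigma> j\<close> is the image coordinate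
    reading \<open>j\<close>. The restriction to \<open>A\<close> gives the extensionality demanded
    by \<open>Bij A\<close>.\<close>
  define \<beta> where "\<beta> j = (\<lambda>a\<in>A. f (replicate n a) ! Hilbert_Choice.inv \<sigma> j)" for j
  have \<beta>: "\<beta> j \<in> Bij A" if "j < n" for j
  proof -
    define p where "p = Hilbert_Choice.inv \<sigma> j"
    have p: "p < n" "\<tau> p = j"
      using that permutes_in_image[OF permutes_inv[OF \<sigma>], of j] permutes_inverses(1)[OF \<sigma>, of j]
      by (auto simp: p_def \<sigma>_def)
    have "inj_on (\<beta> j) A"
    proof (rule inj_onI)
      fix a b assume ab: "a \<in> A" "b \<in> A" and eq: "\<beta> j a = \<beta> j b"
      \<comment> \<open>The two lists can differ only in coordinate \<open>j\<close>, which only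
        \<open>p\<close> reads, and there the images agree by \<open>eq\<close>. Hence the lists are
        equal, and so are \<open>a\<close> and \<open>b\<close>.\<close>
      let ?x = "replicate n a" and ?y = "(replicate n a)[j := b]"
      have N: "?x \<in> N" "?y \<in> N"
        using ab const by (simp_all add: nlists_update_in_list)
      have "f ?x ! i = f ?y ! i" if i: "i < n" for i
      proof (cases "i = p")
        case True
        have "f ?y ! p = f (replicate n b) ! p"
          using f_nth[OF N(2) p(1)] p(2) \<open>j < n\<close> by simp
        then show ?thesis
          using eq ab True by (simp add: \<beta>_def p_def)
      next
        case False
        then have "\<tau> i \<noteq> j"
          using inj_\<tau> i p by (auto simp: inj_on_def)
        then show ?thesis
          using i N \<tau>[OF i] by (intro dep) auto
      qed
      then have "f ?x = f ?y"
        using N closed by (intro nlists_nth_eqI[of _ n A]) auto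
      then have "?x = ?y"
        using inj N by (simp add: inj_on_eq_iff)
      then have "?x ! j = ?y ! j"
        by simp
      then show "a = b"
        using that by simp
    qed
    moreover have "\<beta> j ` A \<subseteq> A"
      using p(1) by (auto simp: \<beta>_def p_def intro!: nlistsE_nth_in closed const)
    ultimately show ?thesis
      using endo_inj_surj[OF finite_A] by (simp add: Bij_def bij_betw_def \<beta>_def)
  qed
  \<comment> \<open>\<open>wire_perm\<close> inverts its parameter, so passing the inverse of
    \<open>\<sigma>\<close> makes image coordinate \<open>p\<close> read argument coordinate
    \<open>\<sigma> p\<close>.\<close>
  have "f = compose N (wire_perm n A (Hilbert_Choice.inv \<sigma>)) (coordwise n A \<beta>)"
  proof (rule extensionalityI[of _ N])
    show "f \<in> extensional N"
      using bij by (simp add: Bij_def)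
    show "compose N (wire_perm n A (Hilbert_Choice.inv \<sigma>)) (coordwise n A \<beta>) \<in> extensional N"
      by (rule compose_extensional)
    fix x assume x: "x \<in> N"
    have cw: "map (\<lambda>i. \<beta> i (x ! i)) [0..<n] \<in> N"
      using \<beta> nlistsE_nth_in[OF x] by (intro map_upt_in_nlists) (auto simp: Bij_def bij_betw_def)
    have "f x = map (\<lambda>p. \<beta> (\<sigma> p) (x ! \<sigma> p)) [0..<n]"
    proof (rule nth_equalityI)
      show "length (f x) = length (map (\<lambda>p. \<beta> (\<sigma> p) (x ! \<sigma> p)) [0..<n])"
        using closed[OF x] by (simp add: nlists_def)
      fix p assume "p < length (f x)"
      then have p: "p < n"
        using closed[OF x] by (simp add: nlists_def)
      then show "f x ! p = map (\<lambda>p. \<beta> (\<sigma> p) (x ! \<sigma> p)) [0..<n] ! p"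
        using f_nth[OF x p] nlistsE_nth_in[OF x] \<tau>[OF p] permutes_inverses(2)[OF \<sigma>, of p]
        by (simp add: \<beta>_def \<sigma>_def)
    qed
    also have "\<dots> = wire_perm n A (Hilbert_Choice.inv \<sigma>) (coordwise n A \<beta> x)"
      using x cw permutes_in_image[OF \<sigma>]
      by (auto simp: wire_perm_def coordwise_def permutes_inv_inv[OF \<sigma>])
    finally show "f x = compose N (wire_perm n A (Hilbert_Choice.inv \<sigma>)) (coordwise n A \<beta>) x"
      using x by (simp add: compose_eq)
  qed
  then show ?thesis
    unfolding Deg_def using \<beta> permutes_inv[OF \<sigma>] by blast
qed

end

section \<open>The converse inclusion: degenerate permutations preserve inequality\<close>

lemma wire_perm_nth:
  assumes "x \<in> nlists n A" "i < n"
  shows "wire_perm n A \<alpha> x ! i = x ! (Hilbert_Choice.inv \<alpha> i)"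
  using assms by (simp add: wire_perm_def)

lemma coordwise_nth:
  assumes "x \<in> nlists n A" "i < n"
  shows "coordwise n A \<beta> x ! i = \<beta> i (x ! i)"
  using assms by (simp add: coordwise_def)

lemma wire_perm_in_Bij:
  assumes "finite A" "\<alpha> permutes {..<n}"
  shows "wire_perm n A \<alpha> \<in> Bij (nlists n A)"
proof (rule Bij_nlistsI[OF assms(1)])
  have inv_less: "Hilbert_Choice.inv \<alpha> i < n \<longleftrightarrow> i < n" for i
    using permutes_in_image[OF permutes_inv[OF assms(2)], of i] by simp
  show "wire_perm n A \<alpha> x \<in> nlists n A" if "x \<in> nlists n A" for x
    using that inv_less by (auto simp: wire_perm_def nlists_def)
  show "inj_on (wire_perm n A \<alpha>) (nlists n A)"
  proof (rule inj_onI)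
    fix x y assume x: "x \<in> nlists n A" and y: "y \<in> nlists n A"
      and eq: "wire_perm n A \<alpha> x = wire_perm n A \<alpha> y"
    show "x = y"
    proof (rule nlists_nth_eqI[OF x y])
      fix i assume "i < n"
      \<comment> \<open>Entry \<open>i\<close> of the argument reappears at coordinate
        \<open>\<alpha> i\<close> of the image.\<close>
      then have "\<alpha> i < n"
        using permutes_in_image[OF assms(2), of i] by simp
      then show "x ! i = y ! i"
        using wire_perm_nth[OF x, of "\<alpha> i" \<alpha>] wire_perm_nth[OF y, of "\<alpha> i" \<alpha>] eq
        by (simp add: permutes_inverses(2)[OF assms(2)])
    qed
  qed
qed (simp add: wire_perm_def)

lemma coordwise_in_Bij:
  assumes "finite A" "\<And>i. i < n \<Longrightarrow> \<beta> i \<in> Bij A"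
  shows "coordwise n A \<beta> \<in> Bij (nlists n A)"
proof (rule Bij_nlistsI[OF assms(1)])
  have \<beta>: "inj_on (\<beta> i) A" "\<beta> i ` A = A" if "i < n" for i
    using assms(2)[OF that] by (auto simp: Bij_def bij_betw_def)
  show "coordwise n A \<beta> x \<in> nlists n A" if "x \<in> nlists n A" for x
    using that \<beta>(2) by (force simp: coordwise_def nlists_def)
  show "inj_on (coordwise n A \<beta>) (nlists n A)"
  proof (rule inj_onI)
    fix x y assume x: "x \<in> nlists n A" and y: "y \<in> nlists n A"
      and eq: "coordwise n A \<beta> x = coordwise n A \<beta> y"
    show "x = y"
    proof (rule nlists_nth_eqI[OF x y])
      fix i assume i: "i < n"
      then have "\<beta> i (x ! i) = \<beta> i (y ! i)"
        using coordwise_nth[OF x i, of \<beta>] coordwise_nth[OF y i, of \<beta>] eq by simp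
      moreover have "x ! i \<in> A" "y ! i \<in> A"
        using x y i by (auto simp: nlists_def)
      ultimately show "x ! i = y ! i"
        using \<beta>(1)[OF i] by (simp add: inj_on_eq_iff)
    qed
  qed
qed (simp add: coordwise_def)

text \<open>Coordinate \<open>i\<close> of the image applies one injective map to one argument
  coordinate, the same for both rows, so rows that differ everywhere keep doing so.\<close>

lemma Deg_subset_PPol:
  assumes "finite A"
  shows "Deg A \<subseteq> PPol A 2 (neq_rel A)"
proof
  fix f assume "f \<in> Deg A"
  then obtain n \<alpha> \<beta> where f: "f = compose (nlists n A) (wire_perm n A \<alpha>) (coordwise n A \<beta>)"
    and \<alpha>: "\<alpha> permutes {..<n}" and \<beta>: "\<And>i. i < n \<Longrightarrow> \<beta> i \<in> Bij A"
    unfolding Deg_def by blast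
  have wp: "wire_perm n A \<alpha> \<in> Bij (nlists n A)"
    using assms \<alpha> by (rule wire_perm_in_Bij)
  have cw: "coordwise n A \<beta> \<in> Bij (nlists n A)"
    using assms \<beta> by (rule coordwise_in_Bij)
  have bij: "f \<in> Bij (nlists n A)"
    unfolding f using wp cw by (rule compose_Bij)
  have f_nth: "f x ! i = \<beta> (Hilbert_Choice.inv \<alpha> i) (x ! Hilbert_Choice.inv \<alpha> i)" "Hilbert_Choice.inv \<alpha> i < n"
    if "x \<in> nlists n A" "i < n" for x i
  proof -
    show "Hilbert_Choice.inv \<alpha> i < n"
      using permutes_in_image[OF permutes_inv[OF \<alpha>], of i] that(2) by simp
    moreover have "coordwise n A \<beta> x \<in> nlists n A"
      using cw that(1) by (auto simp: Bij_def bij_betw_def)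
    ultimately show "f x ! i = \<beta> (Hilbert_Choice.inv \<alpha> i) (x ! Hilbert_Choice.inv \<alpha> i)"
      using that by (simp add: f compose_eq wire_perm_nth coordwise_nth)
  qed
  have "diff_set n (f x) (f y) = {..<n}"
    if x: "x \<in> nlists n A" and y: "y \<in> nlists n A" and D: "diff_set n x y = {..<n}" for x y
  proof -
    have "f x ! i \<noteq> f y ! i" if i: "i < n" for i
    proof -
      let ?j = "Hilbert_Choice.inv \<alpha> i"
      have j: "?j < n"
        using f_nth(2)[OF x i] .
      then have "x ! ?j \<noteq> y ! ?j" "x ! ?j \<in> A" "y ! ?j \<in> A"
        using D x y by (auto simp: nlists_def set_eq_iff)
      moreover have "inj_on (\<beta> ?j) A"
        using \<beta>[OF j] by (simp add: Bij_def bij_betw_def)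
      ultimately show ?thesis
        using f_nth(1)[OF x i] f_nth(1)[OF y i] by (simp add: inj_on_eq_iff)
    qed
    then show ?thesis
      by auto
  qed
  moreover have "f x \<in> nlists n A" if "x \<in> nlists n A" for x
    using bij that by (auto simp: Bij_def bij_betw_def)
  ultimately have "preserves n A 2 (neq_rel A) f"
    by (simp add: preserves_neq_rel_iff)
  then show "f \<in> PPol A 2 (neq_rel A)"
    unfolding PPol_def B_def using bij by blast
qed

theorem theorem7:
  fixes A :: "'a set"
  assumes "finite A" and "card A \<ge> 3"
  shows "PPol A 2 (neq_rel A) = Deg A"
proof
  show "PPol A 2 (neq_rel A) \<subseteq> Deg A"
  proof
    fix f assume "f \<in> PPol A 2 (neq_rel A)"
    then obtain n where bij: "f \<in> Bij (nlists n A)" and pres: "preserves n A 2 (neq_rel A) f"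
      unfolding PPol_def B_def by blast
    have "f x \<in> nlists n A" if "x \<in> nlists n A" for x
      using bij that by (auto simp: Bij_def bij_betw_def)
    then have "neq_preserving_permutation A n f"
      using assms bij pres by unfold_locales (simp_all add: preserves_neq_rel_iff)
    then show "f \<in> Deg A"
      by (rule neq_preserving_permutation.in_Deg)
  qed
  show "Deg A \<subseteq> PPol A 2 (neq_rel A)"
    using assms(1) by (rule Deg_subset_PPol)
qed

end
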